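(* Let $u=(u^{(0,0)},u_{x+}^{(1,0)},u_{x-}^{(1,0)},u_{y+}^{(0,1)},u_{y-}^{(0,1)})^T\in\mathbb{R}^5$. Then there exists a non-negative measure $\psi$ on the unit sphere $S^2$ which realizes $u$ with respect to the first-order mixed-moment basis, i.e. such that $$u^{(0,0)}=\int_{S^2}\psi\,d\Omega,\quad u_{x\pm}^{(1,0)}=\int_{\mathcal S_x^{\pm}}\Omega_x\,\psi\,d\Omega,\quad u_{y\pm}^{(0,1)}=\int_{\mathcal S_y^{\pm}}\Omega_y\,\psi\,d\Omega,$$ if and only if $$\sqrt{\left(u_{x+}^{(1,0)}-u_{x-}^{(1,0)}\right)^2+\left(u_{y+}^{(0,1)}-u_{y-}^{(0,1)}\right)^2}\le u^{(0,0)}$$ and $u_{x+}^{(1,0)}\ge 0$, $u_{y+}^{(0,1)}\ge 0$, $-u_{x-}^{(1,0)}\ge 0$, $-u_{y-}^{(0,1)}\ge 0$.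
   Context: Points of the unit sphere $S^2\subset\mathbb{R}^3$ are parametrized by $\mu\in[-1,1]$ (cosine of the polar angle) and the azimuthal angle $\varphi$. By symmetry in the $z$-direction only the first two components are used: $\Omega=(\Omega_x,\Omega_y)^T=(\sqrt{1-\mu^2}\cos\varphi,\sqrt{1-\mu^2}\sin\varphi)^T$, so $\|\Omega\|_2\le 1$. The half-spaces are $\mathcal S_x^+=\{\Omega_x\ge 0\}$, i.e. $\varphi\in[-\pi/2,\pi/2]$; $\mathcal S_x^-=\{\Omega_x\le 0\}$, i.e. $\varphi\in[\pi/2,3\pi/2]$; $\mathcal S_y^+=\{\Omega_y\ge 0\}$, i.e. $\varphi\in[0,\pi]$; $\mathcal S_y^-=\{\Omega_y\le 0\}$, i.e. $\varphi\in[\pi,2\pi]$ (each with $\mu\in[-1,1]$). The first-order mixed-moment basis is $(1,\Omega_x 1_{\mathcal S_x^+},\Omega_x 1_{\mathcal S_x^-},\Omega_y 1_{\mathcal S_y^+},\Omega_y 1_{\mathcal S_y^-})^T$. "Distributions" $\psi$ are finite non-negative measures (Dirac masses are allowed); $\int f\,\psi\,d\Omega$ denotes integration of $f$ against this measure. *)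

theory Defs
  imports "HOL-Analysis.Analysis"
begin

definition S2 :: "(real^3) set" where
  "S2 = sphere 0 1"

definition Omega_x :: "real^3 \<Rightarrow> real" where
  "Omega_x w = w $ 1"

definition Omega_y :: "real^3 \<Rightarrow> real" where
  "Omega_y w = w $ 2"

definition Sx_plus :: "(real^3) set" where
  "Sx_plus = {w \<in> S2. Omega_x w \<ge> 0}"

definition Sx_minus :: "(real^3) set" where
  "Sx_minus = {w \<in> S2. Omega_x w \<le> 0}"

definition Sy_plus :: "(real^3) set" where
  "Sy_plus = {w \<in> S2. Omega_y w \<ge> 0}"

definition Sy_minus :: "(real^3) set" where
  "Sy_minus = {w \<in> S2. Omega_y w \<le> 0}"

text \<open>The parametrization by the cosine mu of the polar angle and the azimuthal angle phi.\<close>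

definition sphere_point :: "real \<Rightarrow> real \<Rightarrow> real^3" where
  "sphere_point mu phi =
     vector [sqrt (1 - mu\<^sup>2) * cos phi, sqrt (1 - mu\<^sup>2) * sin phi, mu]"

lemma Omega_sphere_point:
  "Omega_x (sphere_point mu phi) = sqrt (1 - mu\<^sup>2) * cos phi"
  "Omega_y (sphere_point mu phi) = sqrt (1 - mu\<^sup>2) * sin phi"
  by (simp_all add: Omega_x_def Omega_y_def sphere_point_def)

lemma mem_S2_iff: "w \<in> S2 \<longleftrightarrow> (w $ 1)\<^sup>2 + (w $ 2)\<^sup>2 + (w $ 3)\<^sup>2 = 1"
  by (simp add: S2_def norm_vec_def L2_set_def sum_3)

lemma S2_eq_sphere_point: "S2 = {sphere_point mu phi | mu phi. mu \<in> {-1..1}}"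
proof (intro equalityI subsetI)
  fix w assume "w \<in> S2"
  then have eq: "(w $ 1)\<^sup>2 + (w $ 2)\<^sup>2 = 1 - (w $ 3)\<^sup>2"
    by (simp add: mem_S2_iff)
  have "0 \<le> (w $ 1)\<^sup>2 + (w $ 2)\<^sup>2"
    by simp
  with eq have "(w $ 3)\<^sup>2 \<le> 1"
    by linarith
  then have mu: "w $ 3 \<in> {-1..1}"
    by (simp add: abs_square_le_1 abs_le_iff)
  obtain r a where ra: "Complex (w $ 1) (w $ 2) = rcis r a" "r = cmod (Complex (w $ 1) (w $ 2))"
    using rcis_cmod_Arg by metis
  have "r = sqrt (1 - (w $ 3)\<^sup>2)"
    using ra(2) eq by (simp add: cmod_def)
  moreover have "w $ 1 = r * cos a" "w $ 2 = r * sin a"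
    using arg_cong[OF ra(1), of Re] arg_cong[OF ra(1), of Im] by simp_all
  ultimately have "w = sphere_point (w $ 3) a"
    by (simp add: sphere_point_def vec_eq_iff forall_3)
  with mu show "w \<in> {sphere_point mu phi | mu phi. mu \<in> {-1..1}}"
    by blast
next
  fix w assume "w \<in> {sphere_point mu phi | mu phi. mu \<in> {-1..1}}"
  then obtain mu phi where w: "w = sphere_point mu phi" and mu: "mu \<in> {-1..1}"
    by blast
  have "mu\<^sup>2 \<le> 1"
    using mu by (simp add: abs_square_le_1 abs_le_iff)
  moreover have "(1 - mu\<^sup>2) * (cos phi)\<^sup>2 + (1 - mu\<^sup>2) * (sin phi)\<^sup>2 = 1 - mu\<^sup>2"
    by (simp add: distrib_left[symmetric])
  ultimately show "w \<in> S2"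
    by (simp add: w mem_S2_iff sphere_point_def power_mult_distrib)
qed

text \<open>A distribution is an arbitrary finite Borel measure on the sphere, not necessarily
  one with a density. Finiteness makes all the Bochner integrals below exist.\<close>

definition sphere_distribution :: "(real^3) measure \<Rightarrow> bool" where
  "sphere_distribution psi \<longleftrightarrow>
     space psi = S2 \<and> sets psi = sets (restrict_space borel S2) \<and> finite_measure psi"

definition realizes_mixed ::
  "(real^3) measure \<Rightarrow> real \<Rightarrow> real \<Rightarrow> real \<Rightarrow> real \<Rightarrow> real \<Rightarrow> bool" where
  "realizes_mixed psi u0 uxp uxm uyp uym \<longleftrightarrow>
     u0 = (LINT w:S2|psi. 1) \<and>
     uxp = (LINT w:Sx_plus|psi. Omega_x w) \<and>
     uxm = (LINT w:Sx_minus|psi. Omega_x w) \<and>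
     uyp = (LINT w:Sy_plus|psi. Omega_y w) \<and>
     uym = (LINT w:Sy_minus|psi. Omega_y w)"

end

(*
  Necessity: put a = int |Omega_x|, b = int |Omega_y| and r = sqrt (a^2 + b^2). By Cauchy-Schwarz
  a |Omega_x| + b |Omega_y| <= r on the sphere, and integrating gives r^2 <= r u0.

  Sufficiency: with p = (uxp - uxm) / u0 and q = (uyp - uym) / u0, four atoms at the points
  (+-p, +-q, sqrt (1 - p^2 - q^2)) suffice. Their weights form a product: the total mass u0 is split
  in the ratio uxp : -uxm between the signs of p, and in the ratio uyp : -uym between those of q.
*)

theory Submission
  imports Defs
begin

lemma S2_borel: "S2 \<in> sets borel"
  by (simp add: S2_def)

lemma Omega_borel_measurable [measurable]:
  "Omega_x \<in> borel_measurable borel" "Omega_y \<in> borel_measurable borel"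
  unfolding Omega_x_def[abs_def] Omega_y_def[abs_def]
  by (intro borel_measurable_continuous_onI continuous_intros)+

lemma half_sphere_borel:
  "Sx_plus \<in> sets borel" "Sx_minus \<in> sets borel" "Sy_plus \<in> sets borel" "Sy_minus \<in> sets borel"
proof -
  note [measurable] = S2_borel
  show "Sx_plus \<in> sets borel" "Sx_minus \<in> sets borel"
    "Sy_plus \<in> sets borel" "Sy_minus \<in> sets borel"
    unfolding Sx_plus_def Sx_minus_def Sy_plus_def Sy_minus_def by measurable
qed

lemma S2_abs_component_le_1:
  assumes "w \<in> S2"
  shows "\<bar>Omega_x w\<bar> \<le> 1" "\<bar>Omega_y w\<bar> \<le> 1"
  using assms component_le_norm_cart[of w] by (auto simp: S2_def Omega_x_def Omega_y_def)

text \<open>The projection of a unit vector to the first two coordinates has norm at most 1, so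
  Cauchy-Schwarz in the plane applies, for \<open>a\<close> and \<open>b\<close> of any
  sign.\<close>

lemma S2_Cauchy_Schwarz:
  assumes "w \<in> S2"
  shows "a * \<bar>Omega_x w\<bar> + b * \<bar>Omega_y w\<bar> \<le> sqrt (a\<^sup>2 + b\<^sup>2)"
proof (rule real_le_rsqrt)
  have "(Omega_x w)\<^sup>2 + (Omega_y w)\<^sup>2 + (w $ 3)\<^sup>2 = 1"
    using assms by (simp add: mem_S2_iff Omega_x_def Omega_y_def)
  then have "(Omega_x w)\<^sup>2 + (Omega_y w)\<^sup>2 \<le> 1"
    using zero_le_power2[of "w $ 3"] by linarith
  then have "(a\<^sup>2 + b\<^sup>2) * ((Omega_x w)\<^sup>2 + (Omega_y w)\<^sup>2) \<le> a\<^sup>2 + b\<^sup>2"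
    by (intro mult_left_le) auto
  \<comment> \<open>Lagrange's identity; dropping the second square gives Cauchy-Schwarz.\<close>
  moreover have "(a * \<bar>Omega_x w\<bar> + b * \<bar>Omega_y w\<bar>)\<^sup>2 + (a * \<bar>Omega_y w\<bar> - b * \<bar>Omega_x w\<bar>)\<^sup>2
      = (a\<^sup>2 + b\<^sup>2) * (\<bar>Omega_x w\<bar>\<^sup>2 + \<bar>Omega_y w\<bar>\<^sup>2)"
    by algebra
  ultimately show "(a * \<bar>Omega_x w\<bar> + b * \<bar>Omega_y w\<bar>)\<^sup>2 \<le> a\<^sup>2 + b\<^sup>2"
    using zero_le_power2[of "a * \<bar>Omega_y w\<bar> - b * \<bar>Omega_x w\<bar>"]
    unfolding power2_abs by linarith
qed

text \<open>The bound is asked for on \<open>S2\<close> only, since that is the whole space of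
  \<open>psi\<close>; the coordinate functions are unbounded on \<open>real^3\<close>.\<close>

lemma sphere_distribution_integrable:
  assumes "sphere_distribution psi" and [measurable]: "f \<in> borel_measurable borel"
    and bound: "\<And>w. w \<in> S2 \<Longrightarrow> norm (f w) \<le> B"
  shows "integrable psi (f :: real^3 \<Rightarrow> real)"
proof -
  interpret finite_measure psi
    using assms(1) by (simp add: sphere_distribution_def)
  have "f \<in> borel_measurable psi"
    using assms(1) measurable_restrict_space1[OF assms(2), of S2]
    by (simp add: sphere_distribution_def cong: measurable_cong_sets)
  moreover have "AE w in psi. norm (f w) \<le> B"
    using assms(1) bound by (intro AE_I2) (simp add: sphere_distribution_def)
  ultimately show ?thesis
    using integrable_const_bound by blast
qed

lemma sphere_distribution_set_integrable:
  assumes "sphere_distribution psi" "f \<in> borel_measurable borel" "A \<in> sets borel"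
    and bound: "\<And>w. w \<in> S2 \<Longrightarrow> norm (f w) \<le> B"
  shows "integrable psi (\<lambda>w. indicator A w *\<^sub>R (f w :: real))"
proof (rule sphere_distribution_integrable[where B = B])
  show "(\<lambda>w. indicator A w *\<^sub>R f w) \<in> borel_measurable borel"
    using assms by measurable
  fix w :: "real^3" assume "w \<in> S2"
  \<comment> \<open>The first fact is \<open>0 \<le> B\<close>, which settles the points outside
    \<open>A\<close>.\<close>
  from order_trans[OF norm_ge_zero bound[OF this]] bound[OF this]
  show "norm (indicator A w *\<^sub>R f w) \<le> B"
    by (simp add: indicator_def)
qed (fact assms(1))

lemma realizes_mixed_imp_bounds:
  assumes psi: "sphere_distribution psi" and real: "realizes_mixed psi u0 uxp uxm uyp uym"
  shows "sqrt ((uxp - uxm)\<^sup>2 + (uyp - uym)\<^sup>2) \<le> u0"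
    and "0 \<le> uxp" "uxm \<le> 0" "0 \<le> uyp" "uym \<le> 0"
proof -
  interpret finite_measure psi
    using psi by (simp add: sphere_distribution_def)
  have space: "space psi = S2"
    using psi by (simp add: sphere_distribution_def)
  note r = real[unfolded realizes_mixed_def set_lebesgue_integral_def]
  note int = sphere_distribution_set_integrable[OF psi, where B = 1]
  show "0 \<le> uxp" "0 \<le> uyp"
    using r by (auto intro!: integral_nonneg_AE AE_I2
        simp: indicator_def Sx_plus_def Sy_plus_def)
  \<comment> \<open>The sign is moved inside so that the integrand is non-negative;
    \<open>integral_minus\<close> is removed below to keep it there.\<close>
  have "- uxm = (LINT w|psi. - (indicator Sx_minus w *\<^sub>R Omega_x w))"
    "- uym = (LINT w|psi. - (indicator Sy_minus w *\<^sub>R Omega_y w))"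
    using r by simp_all
  then have "0 \<le> - uxm" "0 \<le> - uym"
    by (auto intro!: integral_nonneg_AE AE_I2
        simp: indicator_def Sx_minus_def Sy_minus_def simp del: Bochner_Integration.integral_minus)
  then show "uxm \<le> 0" "uym \<le> 0" by simp_all
  have "uxp - uxm = (LINT w|psi. indicator Sx_plus w *\<^sub>R Omega_x w - indicator Sx_minus w *\<^sub>R Omega_x w)"
    using r by (simp add: int half_sphere_borel
        Omega_borel_measurable S2_abs_component_le_1 del: real_scaleR_def)
  \<comment> \<open>The two half-spheres overlap where \<open>Omega_x\<close> vanishes, so the
    overlap contributes nothing.\<close>
  also have "\<dots> = (LINT w|psi. \<bar>Omega_x w\<bar>)"
    by (rule Bochner_Integration.integral_cong)
      (auto simp: space indicator_def Sx_plus_def Sx_minus_def)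
  finally have x: "uxp - uxm = (LINT w|psi. \<bar>Omega_x w\<bar>)" .
  have "uyp - uym = (LINT w|psi. indicator Sy_plus w *\<^sub>R Omega_y w - indicator Sy_minus w *\<^sub>R Omega_y w)"
    using r by (simp add: int half_sphere_borel
        Omega_borel_measurable S2_abs_component_le_1 del: real_scaleR_def)
  also have "\<dots> = (LINT w|psi. \<bar>Omega_y w\<bar>)"
    by (rule Bochner_Integration.integral_cong)
      (auto simp: space indicator_def Sy_plus_def Sy_minus_def)
  finally have y: "uyp - uym = (LINT w|psi. \<bar>Omega_y w\<bar>)" .
  have u0: "u0 = measure psi S2"
    using r space sets.top[of psi] by simp
  define a b where "a = uxp - uxm" and "b = uyp - uym"
  have ix: "integrable psi (\<lambda>w. \<bar>Omega_x w\<bar>)" and iy: "integrable psi (\<lambda>w. \<bar>Omega_y w\<bar>)"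
    by (rule sphere_distribution_integrable[OF psi, where B = 1];
        simp add: S2_abs_component_le_1)+
  \<comment> \<open>By \<open>x\<close> and \<open>y\<close>, the coefficients \<open>a\<close> and
    \<open>b\<close> are themselves the integrals of the two absolute values.\<close>
  have "a\<^sup>2 + b\<^sup>2 = (LINT w|psi. a * \<bar>Omega_x w\<bar> + b * \<bar>Omega_y w\<bar>)"
    using ix iy x y by (simp add: a_def b_def power2_eq_square)
  also have "\<dots> \<le> (LINT w|psi. sqrt (a\<^sup>2 + b\<^sup>2))"
    using ix iy by (intro integral_mono) (auto simp: space S2_Cauchy_Schwarz)
  also have "\<dots> = sqrt (a\<^sup>2 + b\<^sup>2) * u0"
    by (simp add: u0 space)
  finally have "sqrt (a\<^sup>2 + b\<^sup>2) * sqrt (a\<^sup>2 + b\<^sup>2) \<le> sqrt (a\<^sup>2 + b\<^sup>2) * u0"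
    by simp
  \<comment> \<open>This covers the case where the root is zero and cannot be cancelled.\<close>
  moreover have "0 \<le> u0" by (simp add: u0)
  ultimately have "sqrt (a\<^sup>2 + b\<^sup>2) \<le> u0"
    by (cases "0 < sqrt (a\<^sup>2 + b\<^sup>2)") (simp_all only: mult_le_cancel_left_pos not_less)
  then show "sqrt ((uxp - uxm)\<^sup>2 + (uyp - uym)\<^sup>2) \<le> u0"
    by (simp add: a_def b_def)
qed

text \<open>The weights live on the index set and are pushed forward along \<open>P\<close>. Hence
  \<open>P\<close> may fail to be injective: weights of coinciding atoms add up, as happens below
  when \<open>p\<close> or \<open>q\<close> is zero.\<close>

lemma discrete_sphere_distribution:
  fixes P :: "'i \<Rightarrow> real^3" and c :: "'i \<Rightarrow> real"
  assumes "finite I" and P: "\<And>i. i \<in> I \<Longrightarrow> P i \<in> S2" and c: "\<And>i. i \<in> I \<Longrightarrow> 0 \<le> c i"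
  obtains psi where "sphere_distribution psi"
    and "\<And>A (f :: real^3 \<Rightarrow> real). A \<in> sets borel \<Longrightarrow> f \<in> borel_measurable borel \<Longrightarrow>
      (LINT w:A|psi. f w) = (\<Sum>i\<in>I. c i * (indicator A (P i) * f (P i)))"
proof
  let ?M = "point_measure I (\<lambda>i. ennreal (c i))" and ?N = "restrict_space borel S2"
  let ?psi = "distr ?M ?N P"
  have meas: "P \<in> measurable ?M ?N"
    using P by (simp add: space_restrict_space Pi_iff)
  have "finite_measure ?M"
    using assms(1) by (intro finite_measureI)
      (simp add: space_point_measure emeasure_point_measure_finite sum_ennreal[OF c])
  then show "sphere_distribution ?psi"
    by (simp add: sphere_distribution_def space_restrict_space finite_measure.finite_measure_distr[OF _ meas])
  fix A :: "(real^3) set" and f :: "real^3 \<Rightarrow> real"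
  assume "A \<in> sets borel" "f \<in> borel_measurable borel"
  then have "(\<lambda>w. indicator A w *\<^sub>R f w) \<in> borel_measurable ?N"
    by (intro measurable_restrict_space1 borel_measurable_scaleR borel_measurable_indicator)
  then show "(LINT w:A|?psi. f w) = (\<Sum>i\<in>I. c i * (indicator A (P i) * f (P i)))"
    unfolding set_lebesgue_integral_def integral_distr[OF meas]
    using assms(1) c by (subst integral_distr[OF meas]) (simp_all add: lebesgue_integral_point_measure_finite)
qed

lemma bounds_imp_realizes_mixed:
  assumes bound: "sqrt ((uxp - uxm)\<^sup>2 + (uyp - uym)\<^sup>2) \<le> u0"
    and signs: "0 \<le> uxp" "uxm \<le> 0" "0 \<le> uyp" "uym \<le> 0"
  shows "\<exists>psi. sphere_distribution psi \<and> realizes_mixed psi u0 uxp uxm uyp uym"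
proof -
  define a b where "a = uxp - uxm" and "b = uyp - uym"
  define p q where "p = a / u0" and "q = b / u0"
  \<comment> \<open>If \<open>a = 0\<close>, division by zero gives \<open>s = 0\<close>; any value in \<open>[0, 1]\<close> would do. Likewise for \<open>b\<close> and \<open>t\<close>.\<close>
  define s t where "s = uxp / a" and "t = uyp / b"
  define P :: "real \<times> real \<Rightarrow> real^3"
    where "P = (\<lambda>(i, j). vector [i * p, j * q, sqrt (1 - p\<^sup>2 - q\<^sup>2)])"
  define c :: "real \<times> real \<Rightarrow> real"
    where "c = (\<lambda>(i, j). u0 * (if i = 1 then s else 1 - s) * (if j = 1 then t else 1 - t))"
  define I :: "(real \<times> real) set" where "I = {1, -1} \<times> {1, -1}"
  have u0: "0 \<le> u0"
    using bound by (rule order_trans[rotated]) simp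
  have ab: "0 \<le> a" "0 \<le> b"
    using signs by (simp_all add: a_def b_def)
  have st: "0 \<le> s" "s \<le> 1" "0 \<le> t" "t \<le> 1"
    using signs by (auto simp: s_def t_def a_def b_def divide_le_eq_1)
  have le: "a\<^sup>2 + b\<^sup>2 \<le> u0\<^sup>2"
    using bound by (simp add: a_def b_def sqrt_le_D)
  \<comment> \<open>If \<open>u0 = 0\<close>, then \<open>le\<close> forces
    \<open>a = b = 0\<close>, which agrees with the default \<open>p = q = 0\<close> of division by
    zero.\<close>
  have u0pq: "u0 * p = a" "u0 * q = b"
    using le by (auto simp: p_def q_def sum_power2_le_zero_iff)
  \<comment> \<open>If \<open>a = 0\<close>, the sign conditions force \<open>uxp = 0\<close>, so
    the default value of \<open>s\<close> does no harm; likewise for \<open>b\<close> and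
    \<open>t\<close>.\<close>
  have as: "a * s = uxp" "b * t = uyp"
    using signs by (auto simp: s_def t_def a_def b_def)
  then have as': "a * (1 - s) = - uxm" "b * (1 - t) = - uym"
    by (simp_all add: right_diff_distrib a_def b_def)
  have pq: "0 \<le> p" "0 \<le> q"
    using ab u0 by (simp_all add: p_def q_def)
  have "p\<^sup>2 + q\<^sup>2 \<le> 1"
    using le by (auto simp: p_def q_def power_divide add_divide_distrib[symmetric] divide_le_eq_1)
  then have P: "P x \<in> S2" if "x \<in> I" for x
    using that by (auto simp: P_def I_def mem_S2_iff)
  have c: "0 \<le> c x" for x
    using st u0 by (auto simp: c_def split: prod.splits)
  obtain psi where psi: "sphere_distribution psi" and
    int: "\<And>A (f :: real^3 \<Rightarrow> real). A \<in> sets borel \<Longrightarrow> f \<in> borel_measurable borel \<Longrightarrow>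
      (LINT w:A|psi. f w) = (\<Sum>x\<in>I. c x * (indicator A (P x) * f (P x)))"
    by (rule discrete_sphere_distribution[of I P c]) (use P c in \<open>auto simp: I_def\<close>)
  have I_sum: "sum h I = h (1, 1) + h (1, -1) + h (-1, 1) + h (-1, -1)"
    for h :: "real \<times> real \<Rightarrow> real"
    by (simp add: I_def sum.cartesian_product[symmetric])
  have mem_I: "(1, 1) \<in> I" "(1, -1) \<in> I" "(-1, 1) \<in> I" "(-1, -1) \<in> I"
    by (simp_all add: I_def)
  have P_mem: "P (1, 1) \<in> S2" "P (1, -1) \<in> S2" "P (-1, 1) \<in> S2" "P (-1, -1) \<in> S2"
    using P mem_I by simp_all
  have Omega_P: "Omega_x (P (i, j)) = i * p" "Omega_y (P (i, j)) = j * q" for i j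
    by (simp_all add: P_def Omega_x_def Omega_y_def)
  \<comment> \<open>Stated for the products because the indicators alone depend on whether
    \<open>p\<close> or \<open>q\<close> is zero: an atom with \<open>p = 0\<close> lies in both
    half-spheres, but its \<open>Omega_x\<close> is then zero.\<close>
  have ind: "indicator Sx_plus (P (i, j)) * Omega_x (P (i, j)) = (if i = 1 then p else 0)"
    "indicator Sx_minus (P (i, j)) * Omega_x (P (i, j)) = (if i = 1 then 0 else - p)"
    "indicator Sy_plus (P (i, j)) * Omega_y (P (i, j)) = (if j = 1 then q else 0)"
    "indicator Sy_minus (P (i, j)) * Omega_y (P (i, j)) = (if j = 1 then 0 else - q)"
    if "(i, j) \<in> I" for i j
    using that pq P[OF that]
    by (auto simp: I_def indicator_def Sx_plus_def Sx_minus_def Sy_plus_def Sy_minus_def Omega_P)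
  have "(LINT w:S2|psi. 1) = u0"
    by (simp add: int S2_borel I_sum P_mem c_def) (simp add: algebra_simps)
  \<comment> \<open>By the product form of the weights, summing over the other sign removes its
    factor: \<open>t + (1 - t) = 1\<close> for the x-moments, and the same with \<open>s\<close> for
    the y-moments.\<close>
  moreover have "(LINT w:Sx_plus|psi. Omega_x w) = u0 * p * s"
    "(LINT w:Sx_minus|psi. Omega_x w) = - (u0 * p * (1 - s))"
    "(LINT w:Sy_plus|psi. Omega_y w) = u0 * q * t"
    "(LINT w:Sy_minus|psi. Omega_y w) = - (u0 * q * (1 - t))"
    by (simp_all add: int half_sphere_borel Omega_borel_measurable I_sum ind mem_I,
        simp_all add: I_def c_def algebra_simps)
  ultimately have "realizes_mixed psi u0 uxp uxm uyp uym"
    by (simp add: realizes_mixed_def u0pq as as')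
  with psi show ?thesis by blast
qed

theorem theorem3p4:
  fixes u0 uxp uxm uyp uym :: real
  shows "(\<exists>psi. sphere_distribution psi \<and> realizes_mixed psi u0 uxp uxm uyp uym) \<longleftrightarrow>
    sqrt ((uxp - uxm)\<^sup>2 + (uyp - uym)\<^sup>2) \<le> u0 \<and>
    uxp \<ge> 0 \<and> uyp \<ge> 0 \<and> - uxm \<ge> 0 \<and> - uym \<ge> 0"
  using realizes_mixed_imp_bounds bounds_imp_realizes_mixed
  unfolding neg_0_le_iff_le by meson

end
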